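(* Let $n>k$ be positive integers, let $X$ be a real $n\times k$ matrix with $\mathrm{rank}(X)=k$, let $\Omega$ be a real symmetric positive definite $n\times n$ matrix, and let $K_1,K_2$ be real symmetric positive semidefinite $k\times k$ matrices that are idempotent ($K_1^2=K_1$, $K_2^2=K_2$). If $$\hat{\beta}(\Omega,K_1)=\hat{\beta}(I_n,K_2)\quad\text{for every } y\in\mathbb{R}^n,$$ then $$\hat{\beta}(\Omega,0)=\hat{\beta}(I_n,0)\quad\text{for every } y\in\mathbb{R}^n$$ and $K_1=K_2$.
   Context: For a symmetric positive definite $n\times n$ matrix $\Phi$ and a symmetric positive semidefinite $k\times k$ matrix $K$, the general ridge estimator based on $y\in\mathbb{R}^n$ is $$\hat{\beta}(\Phi,K)=(X^\top\Phi^{-1}X+K)^{-1}X^\top\Phi^{-1}y .$$ $I_n$ is the $n\times n$ identity matrix. *)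

theory Defs
  imports "HOL-Analysis.Analysis"
begin

definition sym_pos_def :: "real^'n^'n \<Rightarrow> bool" where
  "sym_pos_def A \<longleftrightarrow> transpose A = A \<and> (\<forall>x. x \<noteq> 0 \<longrightarrow> x \<bullet> (A *v x) > 0)"

definition sym_pos_semidef :: "real^'n^'n \<Rightarrow> bool" where
  "sym_pos_semidef A \<longleftrightarrow> transpose A = A \<and> (\<forall>x. x \<bullet> (A *v x) \<ge> 0)"

text \<open>
  The type \<open>real^'k^'n\<close> consists of matrices with \<open>'n\<close> rows and \<open>'k\<close> columns.
  \<open>matrix_inv\<close> is the genuine inverse only at invertible matrices; when \<open>\<Phi>\<close> is positive
  definite, \<open>K\<close> positive semidefinite and \<open>X\<close> of full column rank, both inverses
  below exist.
\<close>

definition ridge_estimator ::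
    "real^'k^'n \<Rightarrow> real^'n^'n \<Rightarrow> real^'k^'k \<Rightarrow> real^'n \<Rightarrow> real^'k" where
  "ridge_estimator X \<Phi> K y =
     (matrix_inv (transpose X ** matrix_inv \<Phi> ** X + K)
        ** transpose X ** matrix_inv \<Phi>) *v y"

end

theory Submission
  imports Defs
begin

text \<open>
  Write \<open>W = \<Omega>\<^sup>-\<^sup>1\<close>, \<open>A = X\<^sup>T W X\<close> and \<open>B = X\<^sup>T X\<close>. All of \<open>A\<close>, \<open>B\<close>, \<open>A + K1\<close>, \<open>B + K2\<close> are
  positive definite, hence invertible. Equality of the two ridge estimators for all \<open>y\<close> says exactly
  that \<open>X\<^sup>T W = M X\<^sup>T\<close> for the invertible matrix \<open>M = (A + K1) (B + K2)\<^sup>-\<^sup>1\<close>. Multiplying by \<open>X\<close> on the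
  right gives \<open>A = M B\<close>, and subtracting this from \<open>A + K1 = M (B + K2)\<close> gives \<open>K1 = M K2\<close>.

  In the estimators without penalty the factor \<open>M\<close> therefore cancels:
  \<open>A\<^sup>-\<^sup>1 X\<^sup>T W = (M B)\<^sup>-\<^sup>1 M X\<^sup>T = B\<^sup>-\<^sup>1 X\<^sup>T\<close>. Moreover \<open>K1 = M K2\<close> makes the kernels of \<open>K1\<close> and \<open>K2\<close>
  equal, and these matrices are orthogonal projections, which are determined by their kernels.
\<close>

lemma matrix_inv_right:
  fixes S :: "real^'n^'n"
  assumes "invertible S"
  shows "S ** matrix_inv S = mat 1"
  using assms unfolding invertible_def matrix_inv_def
  by (rule someI2_ex) blast

lemma matrix_inv_left:
  fixes S :: "real^'n^'n"
  assumes "invertible S"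
  shows "matrix_inv S ** S = mat 1"
  using assms unfolding invertible_def matrix_inv_def
  by (rule someI2_ex) blast

lemma invertible_if_pos_def:
  fixes S :: "real^'n^'n"
  assumes "\<And>x. x \<noteq> 0 \<Longrightarrow> x \<bullet> (S *v x) > 0"
  shows "invertible S"
proof -
  have "x = 0" if "S *v x = 0" for x
    using assms[of x] that by fastforce
  then show ?thesis
    by (metis invertible_left_inverse matrix_left_invertible_ker)
qed

lemma pos_def_matrix_inv:
  assumes "sym_pos_def S" "x \<noteq> 0"
  shows "x \<bullet> (matrix_inv S *v x) > 0"
proof -
  have inv: "invertible S"
    using assms(1) by (auto simp: sym_pos_def_def intro: invertible_if_pos_def)
  define z where "z = matrix_inv S *v x"
  have x: "x = S *v z"
    by (simp add: z_def matrix_vector_mul_assoc matrix_inv_right[OF inv])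
  with assms(2) have "z \<noteq> 0"
    by auto
  with assms(1) have "z \<bullet> (S *v z) > 0"
    by (simp add: sym_pos_def_def)
  then show ?thesis
    by (metis inner_commute x z_def)
qed

text \<open>
  The quadratic form of \<open>X\<^sup>T W X + K\<close> at \<open>x\<close> is at least that of \<open>W\<close> at \<open>X x\<close>, and full column rank
  keeps \<open>X x\<close> away from zero.
\<close>

lemma invertible_ridge_gram:
  fixes X :: "real^'k^'n"
  assumes rank: "rank X = CARD('k)"
    and W: "\<And>u. u \<noteq> 0 \<Longrightarrow> u \<bullet> (W *v u) > 0"
    and K: "sym_pos_semidef K"
  shows "invertible (transpose X ** W ** X + K)"
proof (rule invertible_if_pos_def)
  fix x :: "real^'k"
  assume "x \<noteq> 0"
  moreover have "inj ((*v) X)"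
    using rank by (simp add: full_rank_injective)
  ultimately have "X *v x \<noteq> 0"
    by (metis injD matrix_vector_mult_0_right)
  then have "(X *v x) \<bullet> (W *v (X *v x)) > 0"
    by (rule W)
  moreover have "x \<bullet> (transpose X ** W ** X *v x) = (X *v x) \<bullet> (W *v (X *v x))"
    by (metis dot_lmul_matrix matrix_vector_mul_assoc transpose_matrix_vector
        inner_commute)
  moreover have "x \<bullet> (K *v x) \<ge> 0"
    using K by (simp add: sym_pos_semidef_def)
  ultimately show "x \<bullet> ((transpose X ** W ** X + K) *v x) > 0"
    by (simp add: matrix_vector_mult_add_rdistrib inner_add_right)
qed

text \<open>
  Since \<open>K1\<close> and \<open>K2\<close> are idempotent, a left factorisation of each one through the other says that
  \<open>K1 = K1 K2\<close> and \<open>K2 = K2 K1\<close>; by symmetry these two products are transposes of each other.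
\<close>

lemma orthogonal_projections_eqI:
  fixes K1 K2 :: "real^'k^'k"
  assumes sym: "transpose K1 = K1" "transpose K2 = K2"
    and idem: "K1 ** K1 = K1" "K2 ** K2 = K2"
    and fact: "K1 = M ** K2" "K2 = N ** K1"
  shows "K1 = K2"
proof -
  have "K1 ** K2 = K1"
    by (metis fact(1) idem(2) matrix_mul_assoc)
  moreover have "K2 ** K1 = K2"
    by (metis fact(2) idem(1) matrix_mul_assoc)
  ultimately show ?thesis
    by (metis matrix_transpose_mul sym)
qed

text \<open>
  The normal equations \<open>B b = C y\<close> keep their solution when both sides are multiplied by \<open>M\<close>.
\<close>

lemma matrix_inv_cancel_left:
  fixes M B :: "real^'k^'k" and C :: "real^'n^'k"
  assumes "invertible B" "invertible (M ** B)"
  shows "matrix_inv (M ** B) ** (M ** C) = matrix_inv B ** C"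
proof -
  have "matrix_inv (M ** B) ** M = matrix_inv (M ** B) ** (M ** B) ** matrix_inv B"
    by (simp add: matrix_mul_assoc[symmetric] matrix_inv_right[OF assms(1)])
  also have "\<dots> = matrix_inv B"
    by (simp add: matrix_inv_left[OF assms(2)])
  finally show ?thesis
    by (simp add: matrix_mul_assoc)
qed

theorem proposition3p3:
  fixes X :: "real^'k^'n" and \<Omega> :: "real^'n^'n" and K1 K2 :: "real^'k^'k"
  assumes "CARD('k) < CARD('n)"
    and "rank X = CARD('k)"
    and "sym_pos_def \<Omega>"
    and "sym_pos_semidef K1" and "sym_pos_semidef K2"
    and "K1 ** K1 = K1" and "K2 ** K2 = K2"
    and "\<forall>y. ridge_estimator X \<Omega> K1 y = ridge_estimator X (mat 1) K2 y"
  shows "(\<forall>y. ridge_estimator X \<Omega> 0 y = ridge_estimator X (mat 1) 0 y) \<and> K1 = K2"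
proof -
  define W where "W = matrix_inv \<Omega>"
  define A where "A = transpose X ** W ** X"
  define B where "B = transpose X ** X"
  have inv_one: "matrix_inv (mat 1 :: real^'n^'n) = mat 1"
    using matrix_inv_left[of "mat 1 :: real^'n^'n"] by (simp add: invertible_def)
  have zero: "sym_pos_semidef (0 :: real^'k^'k)"
    by (simp add: sym_pos_semidef_def transpose_def vec_eq_iff)
  have invA: "invertible (A + K)" if "sym_pos_semidef K" for K
    unfolding A_def W_def
    by (rule invertible_ridge_gram[OF assms(2) pos_def_matrix_inv[OF assms(3)] that])
  have invB: "invertible (B + K)" if "sym_pos_semidef K" for K
    using invertible_ridge_gram[OF assms(2) _ that, of "mat 1"] by (simp add: B_def)
  define P where "P = A + K1"
  define Q where "Q = B + K2"
  have P: "invertible P" and Q: "invertible Q"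
    using invA invB assms(4,5) by (simp_all add: P_def Q_def)
  define M where "M = P ** matrix_inv Q"
  define N where "N = Q ** matrix_inv P"
  have NM: "N ** M = mat 1"
    unfolding N_def M_def
    by (metis P Q matrix_inv_left matrix_inv_right matrix_mul_assoc matrix_mul_rid)

  have "matrix_inv P ** transpose X ** W = matrix_inv Q ** transpose X"
    using assms(8)
    by (simp add: ridge_estimator_def inv_one matrix_eq P_def Q_def A_def B_def W_def)
  then have XW: "transpose X ** W = M ** transpose X"
    unfolding M_def by (metis P matrix_inv_right matrix_mul_assoc matrix_mul_lid)
  have AB: "A = M ** B"
    by (simp add: A_def B_def XW matrix_mul_assoc)
  have "P = M ** Q"
    unfolding M_def by (metis Q matrix_inv_left matrix_mul_assoc matrix_mul_rid)
  then have K1: "K1 = M ** K2"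
    using AB by (simp add: P_def Q_def matrix_add_ldistrib)
  then have K2: "K2 = N ** K1"
    by (simp add: matrix_mul_assoc NM)
  have "K1 = K2"
    using assms(4,5) orthogonal_projections_eqI[OF _ _ assms(6,7) K1 K2]
    by (simp add: sym_pos_semidef_def)
  moreover have "matrix_inv A ** (transpose X ** W) = matrix_inv B ** transpose X"
    using matrix_inv_cancel_left[of B M "transpose X"] invA[OF zero] invB[OF zero]
    by (simp add: AB XW)
  ultimately show ?thesis
    by (simp add: ridge_estimator_def inv_one matrix_mul_assoc A_def B_def W_def)
qed

end
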